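(* Let $M=(m_1,\dots,m_k)$ be a gridding matrix with a single row and $k\geq 1$ cells, every entry of which is either increasing or decreasing (so $\mathrm{Grid}(M)$ is a $k$-cell skinny grid class), and let $p$ be the number of peaks of $M$, that is, the number of $i\in\{1,\dots,k-1\}$ with $m_i\neq m_{i+1}$. Then $$|\mathrm{Grid}_n(M)|\sim 2^{-p}\,k^n\qquad (n\to\infty).$$
   Context: A permutation of length $n$ is a linear ordering $\sigma=\sigma_1\cdots\sigma_n$ of $1,\dots,n$, identified with its plot $\{(i,\sigma_i)\}$. A gridding matrix $M$ is a matrix each of whose entries (cells) is "increasing", "decreasing" or "blank". Suppose $M$ has $t$ columns (numbered left to right) and $u$ rows (numbered bottom to top). An $M$-gridding of a permutation $\sigma$ of length $n$ is a pair of integer sequences $0=c_0\leq c_1\leq\dots\leq c_t=n$ (column dividers) and $0=r_0\leq r_1\leq\dots\leq r_u=n$ (row dividers) such that for every column $i$ and row $j$ the subsequence of $\sigma$ with indices in $(c_{i-1},c_i]$ and values in $(r_{j-1},r_j]$ is increasing, decreasing or empty according to whether the entry of $M$ in column $i$ and row $j$ is increasing, decreasing or blank. $\mathrm{Grid}_n(M)$ is the set of permutations of length $n$ having at least one $M$-gridding. Here $f(n)\sim g(n)$ means $\lim_{n\to\infty}f(n)/g(n)=1$. *)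

theory Defs
  imports Complex_Main "HOL-Combinatorics.Permutations" "HOL-Library.Landau_Symbols"
begin

datatype cell = Increasing | Decreasing | Blank

text \<open>
  A gridding matrix with \<open>t\<close> columns and \<open>u\<close> rows is a function \<open>M :: nat \<Rightarrow> nat \<Rightarrow> cell\<close>, where
  \<open>M i j\<close> is the entry in column \<open>i \<in> {1..t}\<close> (numbered left to right) and row \<open>j \<in> {1..u}\<close>
  (numbered bottom to top); values outside this range are never inspected.
  A permutation of length \<open>n\<close> is a function \<open>\<sigma>\<close> with \<open>\<sigma> permutes {1..n}\<close>, so that \<open>\<sigma> i\<close> is its
  \<open>i\<close>-th term.
\<close>

text \<open>The subsequence of \<open>\<sigma>\<close> on the index set \<open>A\<close> is of the required kind; an empty subsequence
  counts as increasing and as decreasing.\<close>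

fun fits_cell :: "cell \<Rightarrow> (nat \<Rightarrow> nat) \<Rightarrow> nat set \<Rightarrow> bool" where
  "fits_cell Increasing \<sigma> A \<longleftrightarrow> strict_mono_on A \<sigma>"
| "fits_cell Decreasing \<sigma> A \<longleftrightarrow> strict_antimono_on A \<sigma>"
| "fits_cell Blank \<sigma> A \<longleftrightarrow> A = {}"

text \<open>Natural-number dividers suffice, as all dividers lie between \<open>0\<close> and \<open>n\<close>.\<close>

definition is_divider_seq :: "nat \<Rightarrow> nat \<Rightarrow> (nat \<Rightarrow> nat) \<Rightarrow> bool" where
  "is_divider_seq n t c \<longleftrightarrow> c 0 = 0 \<and> (\<forall>i\<in>{1..t}. c (i - 1) \<le> c i) \<and> c t = n"

definition is_gridding ::
  "nat \<Rightarrow> nat \<Rightarrow> (nat \<Rightarrow> nat \<Rightarrow> cell) \<Rightarrow> nat \<Rightarrow> (nat \<Rightarrow> nat) \<Rightarrow> (nat \<Rightarrow> nat) \<Rightarrow> (nat \<Rightarrow> nat) \<Rightarrow> bool" where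
  "is_gridding t u M n \<sigma> c r \<longleftrightarrow>
     is_divider_seq n t c \<and> is_divider_seq n u r \<and>
     (\<forall>i\<in>{1..t}. \<forall>j\<in>{1..u}.
        fits_cell (M i j) \<sigma> {x \<in> {c (i - 1)<..c i}. \<sigma> x \<in> {r (j - 1)<..r j}})"

definition Grid :: "nat \<Rightarrow> nat \<Rightarrow> (nat \<Rightarrow> nat \<Rightarrow> cell) \<Rightarrow> nat \<Rightarrow> (nat \<Rightarrow> nat) set" where
  "Grid t u M n = {\<sigma>. \<sigma> permutes {1..n} \<and> (\<exists>c r. is_gridding t u M n \<sigma> c r)}"

text \<open>The number of peaks of a single-row gridding matrix with \<open>k\<close> columns.\<close>

definition peaks :: "nat \<Rightarrow> (nat \<Rightarrow> nat \<Rightarrow> cell) \<Rightarrow> nat" where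
  "peaks k M = card {i \<in> {1..k - 1}. M i 1 \<noteq> M (i + 1) 1}"

end

theory Submission
  imports Defs "HOL-Library.Sublist" "HOL-Library.Infinite_Set"
begin

text \<open>
  A permutation together with one of its griddings is the same thing as a word of length \<open>n\<close> over
  the \<open>k\<close> columns: letter \<open>v\<close> of the word is the column that holds the value \<open>v\<close>. The word fixes
  the set of values in each column, and a set of values can be written in increasing (or decreasing)
  order in only one way. Hence there are exactly \<open>k ^ n\<close> gridded permutations (\<open>word_of_bij\<close>), and
  it remains to see that nearly all of them come from a permutation with exactly \<open>2 ^ p\<close> griddings.

  Only the pattern of ascents and descents decides which dividers are valid. Suppose that every
  column holds at least two points and that between two neighbouring columns of the same type the
  permutation steps in the opposite direction. Then a divider between columns of the same type
  cannot move, whereas at a peak the extreme point may belong to either of the two columns, and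
  these choices are independent of each other. This gives \<open>2 ^ p\<close> griddings
  (\<open>card_griddings_of_separated\<close>).

  Both suppositions hold as soon as the word contains the block \<open>1 2 \<dots> k 1 2 \<dots> k\<close>: every
  letter occurs twice, and some letter \<open>i\<close> stands before as well as after some letter \<open>i + 1\<close>
  (\<open>card_griddings_of_generic\<close>). A fixed block is missed by an exponentially small proportion of all
  words (\<open>avoiders_negligible\<close>), so that \<open>2 ^ p\<close> times the number of permutations is
  \<open>k ^ n\<close> up to an error of smaller order (\<open>card_fst_image_bounds\<close>).
\<close>

section \<open>Words avoiding a block\<close>

definition avoiders :: "'a set \<Rightarrow> 'a list \<Rightarrow> nat \<Rightarrow> 'a list set" where
  "avoiders S P n = {xs. set xs \<subseteq> S \<and> length xs = n \<and> \<not> sublist P xs}"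

lemma finite_avoiders: "finite S \<Longrightarrow> finite (avoiders S P n)"
  unfolding avoiders_def
  by (rule finite_subset[OF _ finite_lists_length_eq[of S n]]) auto

lemma card_avoiders_le: "finite S \<Longrightarrow> card (avoiders S P n) \<le> card S ^ n"
  unfolding avoiders_def
  by (subst card_lists_length_eq[symmetric], assumption)
     (auto intro!: card_mono finite_lists_length_eq)

text \<open>The first \<open>length P\<close> letters of a word that avoids \<open>P\<close> are not \<open>P\<close>, and the remaining
  letters avoid \<open>P\<close> again.\<close>

lemma card_avoiders_step:
  assumes "finite S" "set P \<subseteq> S"
  shows "card (avoiders S P (length P + n)) \<le> (card S ^ length P - 1) * card (avoiders S P n)"
proof -
  define U where "U = {us. set us \<subseteq> S \<and> length us = length P} - {P}"
  have fin: "finite U" unfolding U_def using finite_lists_length_eq[OF assms(1)] by auto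
  have cU: "card U = card S ^ length P - 1"
    unfolding U_def using assms
    by (subst card_Diff_singleton) (auto simp: card_lists_length_eq)
  have "avoiders S P (length P + n) \<subseteq> (\<lambda>(u,v). u @ v) ` (U \<times> avoiders S P n)"
  proof
    fix xs assume xs: "xs \<in> avoiders S P (length P + n)"
    let ?u = "take (length P) xs" and ?v = "drop (length P) xs"
    have eq: "xs = ?u @ ?v" by simp
    have "?u \<noteq> P"
    proof
      assume "?u = P"
      then have "xs = [] @ P @ ?v" by (metis append_Nil append_take_drop_id)
      then have "sublist P xs" unfolding sublist_def by blast
      with xs show False by (simp add: avoiders_def)
    qed
    moreover have "set ?u \<subseteq> S" "set ?v \<subseteq> S"
      using xs set_take_subset[of "length P" xs] set_drop_subset[of "length P" xs]
      unfolding avoiders_def by blast+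
    moreover have "\<not> sublist P ?v"
      using xs sublist_order.order_trans[OF _ sublist_drop[of "length P" xs]]
      unfolding avoiders_def by blast
    ultimately have "(?u, ?v) \<in> U \<times> avoiders S P n"
      using xs by (auto simp: avoiders_def U_def)
    with eq show "xs \<in> (\<lambda>(u,v). u @ v) ` (U \<times> avoiders S P n)"
      by (intro image_eqI[of _ _ "(?u, ?v)"]) auto
  qed
  then have "card (avoiders S P (length P + n)) \<le> card (U \<times> avoiders S P n)"
    by (rule surj_card_le[rotated]) (use fin finite_avoiders[OF assms(1)] in auto)
  then show ?thesis by (simp add: card_cartesian_product cU)
qed

text \<open>Cutting a word into segments of the length of \<open>P\<close>, each segment differs from \<open>P\<close> with
  probability \<open>q < 1\<close>, so the proportion of avoiding words is at most \<open>q ^ (n div length P)\<close>.\<close>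

lemma avoiders_negligible:
  assumes "finite S" "set P \<subseteq> S" "P \<noteq> []"
  shows "(\<lambda>n. real (card (avoiders S P n)) / real (card S) ^ n) \<longlonglongrightarrow> 0"
proof -
  define L where "L = length P"
  define q where "q = 1 - 1 / real (card S) ^ L"
  define a where "a = (\<lambda>n. real (card (avoiders S P n)) / real (card S) ^ n)"
  have L: "L > 0" using assms unfolding L_def by simp
  have S: "card S > 0" using assms by (auto simp: card_gt_0_iff)
  have q: "0 \<le> q" "q < 1" unfolding q_def using S by (auto simp: Suc_le_eq)
  have a1: "a n \<le> 1" for n
    unfolding a_def using card_avoiders_le[OF assms(1), of P n] S
    by (simp flip: of_nat_power)
  have step: "a (L + n) \<le> q * a n" for n
  proof -
    have "real (card (avoiders S P (L + n)))
        \<le> real ((card S ^ L - 1) * card (avoiders S P n))"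
      using card_avoiders_step[OF assms(1,2), of n] unfolding L_def by linarith
    also have "\<dots> = (real (card S) ^ L - 1) * real (card (avoiders S P n))"
      using S by (simp add: of_nat_diff Suc_le_eq)
    finally show ?thesis
      unfolding a_def q_def using S by (simp add: power_add field_simps)
  qed
  have pow: "a (L * j + r) \<le> q ^ j" for j r
  proof (induction j)
    case (Suc j)
    have "a (L + (L * j + r)) \<le> q * a (L * j + r)" by (rule step)
    also have "\<dots> \<le> q * q ^ j" using Suc q by (intro mult_left_mono) auto
    finally show ?case by (simp add: add.assoc)
  qed (use a1 in simp)
  have bd: "a n \<le> q ^ (n div L)" for n
    using pow[of "n div L" "n mod L"] by simp
  have "filterlim (\<lambda>n. n div L) at_top sequentially"
    unfolding filterlim_at_top eventually_sequentially
    using L by (metis div_le_mono nonzero_mult_div_cancel_left not_gr_zero)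
  then have "(\<lambda>n. q ^ (n div L)) \<longlonglongrightarrow> 0"
    using LIMSEQ_realpow_zero[OF q] by (rule filterlim_compose[rotated])
  then show ?thesis
    unfolding a_def[symmetric]
    by (rule tendsto_0_le[where K = 1]) (use bd q in \<open>auto simp: a_def\<close>)
qed

section \<open>Gridded permutations and words\<close>

definition fits_columns :: "nat \<Rightarrow> (nat \<Rightarrow> cell) \<Rightarrow> (nat \<Rightarrow> nat) \<Rightarrow> (nat \<Rightarrow> nat) \<Rightarrow> bool" where
  "fits_columns k m \<sigma> c \<longleftrightarrow> (\<forall>i\<in>{1..k}. fits_cell (m i) \<sigma> {c (i - 1)<..c i})"

text \<open>Dividers are restricted to \<open>{0..k}\<close>, since otherwise a single gridding would be represented by
  infinitely many functions.\<close>

definition gridded_perms ::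
  "nat \<Rightarrow> (nat \<Rightarrow> cell) \<Rightarrow> nat \<Rightarrow> ((nat \<Rightarrow> nat) \<times> (nat \<Rightarrow> nat)) set" where
  "gridded_perms k m n = {(\<sigma>, c). \<sigma> permutes {1..n} \<and> c \<in> extensional {0..k} \<and>
     is_divider_seq n k c \<and> fits_columns k m \<sigma> c}"

definition column_of :: "(nat \<Rightarrow> nat) \<Rightarrow> nat \<Rightarrow> nat" where
  "column_of c x = (LEAST i. x \<le> c i)"

definition word_of :: "nat \<Rightarrow> (nat \<Rightarrow> nat) \<times> (nat \<Rightarrow> nat) \<Rightarrow> nat list" where
  "word_of n = (\<lambda>(\<sigma>, c). map (\<lambda>v. column_of c (inv \<sigma> v)) [1..<Suc n])"

definition words :: "nat \<Rightarrow> nat \<Rightarrow> nat list set" where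
  "words k n = {xs. set xs \<subseteq> {1..k} \<and> length xs = n}"

lemma divider_mono:
  assumes "is_divider_seq n k c" "i \<le> j" "j \<le> k"
  shows "c i \<le> c j"
  using assms(2,3)
proof (induction j rule: dec_induct)
  case (step j)
  then have "c (Suc j - 1) \<le> c (Suc j)"
    using assms(1) unfolding is_divider_seq_def by (metis Suc_leD atLeastAtMost_iff le_add1 plus_1_eq_Suc)
  with step show ?case by simp
qed simp

text \<open>Dividers and columns determine each other through this equivalence, like a Galois
  connection; all later facts on \<^term>\<open>column_of\<close> come from it.\<close>

lemma column_of_le_iff:
  assumes "is_divider_seq n k c" "x \<le> n" "i \<le> k"
  shows "column_of c x \<le> i \<longleftrightarrow> x \<le> c i"
proof
  assume "x \<le> c i" then show "column_of c x \<le> i"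
    unfolding column_of_def by (rule Least_le)
next
  assume le: "column_of c x \<le> i"
  have "x \<le> c k" using assms by (simp add: is_divider_seq_def)
  then have "x \<le> c (column_of c x)" unfolding column_of_def by (rule LeastI)
  also have "\<dots> \<le> c i" using divider_mono[OF assms(1) le assms(3)] .
  finally show "x \<le> c i" .
qed

lemma column_of_range:
  assumes "is_divider_seq n k c" "x \<in> {1..n}"
  shows "column_of c x \<in> {1..k}"
proof -
  have "column_of c x \<le> k" using column_of_le_iff[OF assms(1), of x k] assms
    by (auto simp: is_divider_seq_def)
  moreover have "\<not> column_of c x \<le> 0" using column_of_le_iff[OF assms(1), of x 0] assms
    by (auto simp: is_divider_seq_def)
  ultimately show ?thesis by simp
qed

lemma column_of_eq_iff:
  assumes "is_divider_seq n k c" "x \<in> {1..n}" "i \<in> {1..k}"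
  shows "column_of c x = i \<longleftrightarrow> x \<in> {c (i - 1)<..c i}"
proof -
  have "column_of c x = i \<longleftrightarrow> column_of c x \<le> i \<and> \<not> column_of c x \<le> i - 1"
    using assms(3) by auto
  also have "\<dots> \<longleftrightarrow> x \<in> {c (i - 1)<..c i}"
    using column_of_le_iff[OF assms(1), of x] assms by auto
  finally show ?thesis .
qed

lemma cell_subset:
  assumes "is_divider_seq n k c" "i \<in> {1..k}"
  shows "{c (i - 1)<..c i} \<subseteq> {1..n}"
  using divider_mono[OF assms(1), of i k] assms by (auto simp: is_divider_seq_def)

text \<open>Reading the permutation encoded by the word \<open>w\<close> from left to right lists the values in the order
  of this key: first by column, and inside a column upwards or downwards according to its type. The
  factor \<open>Suc n\<close> makes the column dominate.\<close>

definition reading_key :: "nat \<Rightarrow> (nat \<Rightarrow> cell) \<Rightarrow> (nat \<Rightarrow> nat) \<Rightarrow> nat \<Rightarrow> nat" where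
  "reading_key n m w v = Suc n * w v + (if m (w v) = Increasing then v else n - v)"

lemma reading_key_less_iff:
  assumes "u \<in> {1..n}" "v \<in> {1..n}"
  shows "reading_key n m w u < reading_key n m w v \<longleftrightarrow>
    w u < w v \<or> w u = w v \<and> (if m (w v) = Increasing then u < v else v < u)"
proof -
  have *: "reading_key n m w a < reading_key n m w b"
    if "w a < w b" "a \<in> {1..n}" for a b
  proof -
    have "reading_key n m w a < Suc n * w a + Suc n"
      using that unfolding reading_key_def by auto
    also have "\<dots> = Suc n * Suc (w a)" by simp
    also have "\<dots> \<le> Suc n * w b" using that by (intro mult_le_mono2) simp
    also have "\<dots> \<le> reading_key n m w b" unfolding reading_key_def by simp
    finally show ?thesis .
  qed
  consider "w u < w v" | "w v < w u" | "w u = w v" by linarith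
  then show ?thesis
  proof cases
    case 1 with *[OF 1] assms show ?thesis by simp
  next
    case 2 with *[OF 2] assms show ?thesis by (simp add: not_less)
  next
    case 3 then show ?thesis using assms unfolding reading_key_def by auto
  qed
qed

lemma inj_on_reading_key: "inj_on (reading_key n m w) {1..n}"
proof (rule inj_onI)
  fix u v assume *: "u \<in> {1..n}" "v \<in> {1..n}" "reading_key n m w u = reading_key n m w v"
  then show "u = v"
    using reading_key_less_iff[OF *(1,2), of m w] reading_key_less_iff[OF *(2,1), of m w]
    by (metis less_irrefl linorder_neqE_nat)
qed

text \<open>A permutation that sorts by a key is determined by the key, since position \<open>x\<close> is the rank of
  the key at \<open>x\<close>.\<close>

lemma sorting_permutation_unique:
  fixes key :: "nat \<Rightarrow> nat"
  assumes "\<sigma> permutes {1..n}" "strict_mono_on {1..n} (key \<circ> \<sigma>)"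
    and "\<tau> permutes {1..n}" "strict_mono_on {1..n} (key \<circ> \<tau>)"
  shows "\<sigma> = \<tau>"
proof
  fix x
  have rank: "card {v \<in> {1..n}. key v \<le> key (\<rho> y)} = y"
    if r: "\<rho> permutes {1..n}" "strict_mono_on {1..n} (key \<circ> \<rho>)" "y \<in> {1..n}" for \<rho> y
  proof -
    have "{v \<in> {1..n}. key v \<le> key (\<rho> y)} = \<rho> ` {1..y}"
    proof (intro set_eqI iffI)
      fix v assume v: "v \<in> {v \<in> {1..n}. key v \<le> key (\<rho> y)}"
      then obtain z where z: "z \<in> {1..n}" "v = \<rho> z"
        using permutes_image[OF r(1)] by blast
      have "\<not> y < z"
      proof
        assume "y < z"
        then have "(key \<circ> \<rho>) y < (key \<circ> \<rho>) z" using that z by (intro strict_mono_onD[OF that(2)]) auto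
        with v z show False by simp
      qed
      with z show "v \<in> \<rho> ` {1..y}" by auto
    next
      fix v assume "v \<in> \<rho> ` {1..y}"
      then obtain z where z: "z \<in> {1..y}" "v = \<rho> z" by blast
      then have zn: "z \<in> {1..n}" using that by auto
      have "(key \<circ> \<rho>) z \<le> (key \<circ> \<rho>) y"
        using strict_mono_onD[OF that(2) zn that(3)] z by (cases "z = y") (auto simp: less_imp_le)
      moreover have "\<rho> z \<in> {1..n}" using permutes_in_image[OF that(1)] zn by blast
      ultimately show "v \<in> {v \<in> {1..n}. key v \<le> key (\<rho> y)}" using z by simp
    qed
    then show ?thesis
      using card_image[OF inj_on_subset[OF permutes_inj[OF that(1)]], of "{1..y}"] by simp
  qed
  show "\<sigma> x = \<tau> x"
  proof (cases "x \<in> {1..n}")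
    case True
    define y where "y = inv \<tau> (\<sigma> x)"
    have ty: "\<tau> y = \<sigma> x" unfolding y_def using permutes_inverses(1)[OF assms(3)] .
    have "\<sigma> x \<in> {1..n}" using permutes_in_image[OF assms(1)] True by blast
    then have "y \<in> {1..n}" using permutes_in_image[OF assms(3)] ty by metis
    then have "y = x" using rank[OF assms(3,4)] rank[OF assms(1,2) True] ty by metis
    with ty show ?thesis by simp
  next
    case False then show ?thesis using assms by (simp add: permutes_def)
  qed
qed

lemma sorting_permutation_exists:
  fixes key :: "nat \<Rightarrow> nat"
  assumes inj: "inj_on key {1..n}"
  obtains \<sigma> where "\<sigma> permutes {1..n}" "strict_mono_on {1..n} (key \<circ> \<sigma>)"
proof -
  have "card (key ` {1..n}) = n" using card_image[OF inj] by simp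
  then obtain h where h: "bij_betw h {..<n} (key ` {1..n})" "strict_mono_on {..<n} h"
    using ex_bij_betw_strict_mono_card[of "key ` {1..n}"] by auto
  define \<sigma> where "\<sigma> x = (if x \<in> {1..n} then inv_into {1..n} key (h (x - 1)) else x)" for x
  have hx: "h (x - 1) \<in> key ` {1..n}" if "x \<in> {1..n}" for x
    using h(1) that by (auto simp: bij_betw_def)
  have key: "key (\<sigma> x) = h (x - 1)" if "x \<in> {1..n}" for x
    using hx[OF that] that by (simp add: \<sigma>_def f_inv_into_f)
  have mono: "strict_mono_on {1..n} (key \<circ> \<sigma>)"
  proof (rule strict_mono_onI)
    fix x y assume "x \<in> {1..n}" "y \<in> {1..n}" "x < y"
    then show "(key \<circ> \<sigma>) x < (key \<circ> \<sigma>) y"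
      using strict_mono_onD[OF h(2), of "x - 1" "y - 1"] by (auto simp: key)
  qed
  have "inj_on \<sigma> {1..n}"
    using strict_mono_on_imp_inj_on[OF mono] by (rule inj_on_imageI2)
  moreover have "\<sigma> ` {1..n} \<subseteq> {1..n}"
  proof
    fix v assume "v \<in> \<sigma> ` {1..n}"
    then obtain x where x: "x \<in> {1..n}" "v = \<sigma> x" by blast
    then have "v = inv_into {1..n} key (h (x - 1))" by (simp add: \<sigma>_def)
    then show "v \<in> {1..n}" using inv_into_into[OF hx[OF x(1)]] by simp
  qed
  ultimately have "bij_betw \<sigma> {1..n} {1..n}"
    by (simp add: bij_betw_def endo_inj_surj)
  then have "\<sigma> permutes {1..n}"
    by (rule bij_imp_permutes) (simp add: \<sigma>_def del: atLeastAtMost_iff)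
  with mono show thesis by (rule that[rotated])
qed

text \<open>Hence a word determines the permutation of any gridded permutation that it encodes.\<close>

lemma fits_columns_imp_sorting:
  assumes perm: "\<sigma> permutes {1..n}" and div: "is_divider_seq n k c"
    and types: "\<forall>i\<in>{1..k}. m i = Increasing \<or> m i = Decreasing"
    and fits: "fits_columns k m \<sigma> c"
    and w: "\<And>v. v \<in> {1..n} \<Longrightarrow> w v = column_of c (inv \<sigma> v)"
  shows "strict_mono_on {1..n} (reading_key n m w \<circ> \<sigma>)"
proof (rule strict_mono_onI)
  fix x y assume xy: "x \<in> {1..n}" "y \<in> {1..n}" "x < y"
  have s: "\<sigma> x \<in> {1..n}" "\<sigma> y \<in> {1..n}" using permutes_in_image[OF perm] xy by auto
  have wx: "w (\<sigma> x) = column_of c x" "w (\<sigma> y) = column_of c y"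
    using w s permutes_inverses(2)[OF perm] by auto
  have ry: "column_of c y \<in> {1..k}" using column_of_range[OF div xy(2)] .
  have "y \<le> c (column_of c y)"
    using column_of_le_iff[OF div, of y "column_of c y"] xy ry by auto
  then have le: "column_of c x \<le> column_of c y"
    using column_of_le_iff[OF div, of x "column_of c y"] xy ry by auto
  have "if m (column_of c y) = Increasing then \<sigma> x < \<sigma> y else \<sigma> y < \<sigma> x"
    if eq: "column_of c x = column_of c y"
  proof -
    let ?i = "column_of c y" let ?A = "{c (?i - 1)<..c ?i}"
    have A: "x \<in> ?A" "y \<in> ?A"
      using column_of_eq_iff[OF div _ ry] xy eq by blast+
    have f: "fits_cell (m ?i) \<sigma> ?A" using fits ry by (simp add: fits_columns_def)
    show ?thesis
    proof (cases "m ?i = Increasing")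
      case True then show ?thesis using f A xy by (auto intro: strict_mono_onD)
    next
      case False
      then have "m ?i = Decreasing" using types ry by blast
      then show ?thesis using f A xy by (auto simp: monotone_on_def)
    qed
  qed
  with le show "(reading_key n m w \<circ> \<sigma>) x < (reading_key n m w \<circ> \<sigma>) y"
    using reading_key_less_iff[OF s, of m w] wx by auto
qed

text \<open>The dividers are recovered from the word as numbers of letters that are at most \<open>i\<close>.\<close>

lemma card_column_le:
  assumes perm: "\<sigma> permutes {1..n}" and div: "is_divider_seq n k c" and i: "i \<le> k"
  shows "card {v \<in> {1..n}. column_of c (inv \<sigma> v) \<le> i} = c i"
proof -
  have cn: "c i \<le> n" using divider_mono[OF div i] div by (simp add: is_divider_seq_def)
  have "{v \<in> {1..n}. column_of c (inv \<sigma> v) \<le> i} = \<sigma> ` {1..c i}"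
  proof (intro set_eqI iffI)
    fix v assume v: "v \<in> {v \<in> {1..n}. column_of c (inv \<sigma> v) \<le> i}"
    have x: "inv \<sigma> v \<in> {1..n}" using v permutes_in_image[OF permutes_inv[OF perm]] by blast
    then have "inv \<sigma> v \<le> c i" using v column_of_le_iff[OF div _ i] by auto
    then show "v \<in> \<sigma> ` {1..c i}"
      using x permutes_inverses(1)[OF perm] by (intro image_eqI[of _ _ "inv \<sigma> v"]) auto
  next
    fix v assume "v \<in> \<sigma> ` {1..c i}"
    then obtain x where x: "x \<in> {1..c i}" "v = \<sigma> x" by blast
    moreover from x cn have "x \<in> {1..n}" by auto
    moreover from this have "\<sigma> x \<in> {1..n}" using permutes_in_image[OF perm] by blast
    ultimately show "v \<in> {v \<in> {1..n}. column_of c (inv \<sigma> v) \<le> i}"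
      using column_of_le_iff[OF div _ i] permutes_inverses(2)[OF perm] by auto
  qed
  then show ?thesis
    using card_image[OF inj_on_subset[OF permutes_inj[OF perm]], of "{1..c i}"] by simp
qed

lemma word_of_nth:
  assumes "v \<in> {1..n}"
  shows "word_of n (\<sigma>, c) ! (v - 1) = column_of c (inv \<sigma> v)"
  using assms by (auto simp add: word_of_def simp del: upt_Suc)

lemma down_closed_eq_initial:
  fixes S :: "nat set"
  assumes "S \<subseteq> {1..n}" "\<And>x y. y \<in> S \<Longrightarrow> 1 \<le> x \<Longrightarrow> x \<le> y \<Longrightarrow> x \<in> S"
  shows "S = {1..card S}"
proof (cases "S = {}")
  case False
  have fin: "finite S" using assms(1) finite_subset by blast
  have "S = {1..Max S}"
    using assms(1) assms(2)[OF Max_in[OF fin False]] Max_ge[OF fin] by auto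
  then have "S = {1..Max S}" "card S = Max S" by (auto dest: arg_cong[of _ _ card])
  then show ?thesis by simp
qed simp

text \<open>Injectivity recovers the dividers by counting letters and the permutation by sorting;
  surjectivity builds a gridded permutation from a word by the same two recipes.\<close>

lemma word_of_bij:
  assumes types: "\<forall>i\<in>{1..k}. m i = Increasing \<or> m i = Decreasing"
  shows "bij_betw (word_of n) (gridded_perms k m n) (words k n)"
proof (rule bij_betw_imageI)
  show "inj_on (word_of n) (gridded_perms k m n)"
  proof (rule inj_onI, clarify)
    fix \<sigma> c \<tau> d
    assume a: "(\<sigma>, c) \<in> gridded_perms k m n" "(\<tau>, d) \<in> gridded_perms k m n"
      and eq: "word_of n (\<sigma>, c) = word_of n (\<tau>, d)"
    have p: "\<sigma> permutes {1..n}" "is_divider_seq n k c" "fits_columns k m \<sigma> c"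
        "\<tau> permutes {1..n}" "is_divider_seq n k d" "fits_columns k m \<tau> d"
        "c \<in> extensional {0..k}" "d \<in> extensional {0..k}"
      using a by (auto simp: gridded_perms_def)
    have cols: "column_of c (inv \<sigma> v) = column_of d (inv \<tau> v)" if "v \<in> {1..n}" for v
      using word_of_nth[OF that] eq by metis
    define w where "w = (\<lambda>v. column_of c (inv \<sigma> v))"
    have "c = d"
    proof (rule extensionalityI[OF p(7,8)])
      fix i assume "i \<in> {0..k}"
      then have i: "i \<le> k" by simp
      have "{v \<in> {1..n}. column_of c (inv \<sigma> v) \<le> i} = {v \<in> {1..n}. column_of d (inv \<tau> v) \<le> i}"
        using cols by auto
      then show "c i = d i"
        using card_column_le[OF p(1,2) i] card_column_le[OF p(4,5) i] by simp
    qed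
    moreover have "\<sigma> = \<tau>"
      by (rule sorting_permutation_unique[OF p(1) _ p(4), of "reading_key n m w"];
          rule fits_columns_imp_sorting[OF _ _ types])
         (use p cols in \<open>auto simp: w_def\<close>)
    ultimately show "\<sigma> = \<tau> \<and> c = d" by simp
  qed
next
  show "word_of n ` gridded_perms k m n = words k n"
  proof (intro equalityI subsetI)
    fix xs assume "xs \<in> word_of n ` gridded_perms k m n"
    then obtain \<sigma> c where p: "\<sigma> permutes {1..n}" "is_divider_seq n k c" "xs = word_of n (\<sigma>, c)"
      by (auto simp: gridded_perms_def)
    have "column_of c (inv \<sigma> v) \<in> {1..k}" if "v \<in> {1..n}" for v
      using column_of_range[OF p(2)] permutes_in_image[OF permutes_inv[OF p(1)]] that by blast
    then show "xs \<in> words k n" unfolding words_def p(3) word_of_def by (auto simp del: upt_Suc)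
  next
    fix xs assume xs: "xs \<in> words k n"
    define w where "w v = xs ! (v - 1)" for v
    have w: "w v \<in> {1..k}" if "v \<in> {1..n}" for v
    proof -
      have "xs ! (v - 1) \<in> set xs" using xs that by (intro nth_mem) (auto simp: words_def)
      then show ?thesis using xs unfolding words_def w_def by blast
    qed
    obtain \<sigma> where perm: "\<sigma> permutes {1..n}"
      and sort: "strict_mono_on {1..n} (reading_key n m w \<circ> \<sigma>)"
      using sorting_permutation_exists[OF inj_on_reading_key] .
    have s: "\<sigma> x \<in> {1..n}" if "x \<in> {1..n}" for x using permutes_in_image[OF perm] that by blast
    have ord: "w (\<sigma> x) < w (\<sigma> y) \<or> w (\<sigma> x) = w (\<sigma> y) \<and>
        (if m (w (\<sigma> y)) = Increasing then \<sigma> x < \<sigma> y else \<sigma> y < \<sigma> x)"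
      if "x \<in> {1..n}" "y \<in> {1..n}" "x < y" for x y
      using strict_mono_onD[OF sort that] reading_key_less_iff[OF s[OF that(1)] s[OF that(2)]]
      by simp
    define c where "c = restrict (\<lambda>i. card {x \<in> {1..n}. w (\<sigma> x) \<le> i}) {0..k}"
    \<comment> \<open>Sorting puts the points of the first \<open>i\<close> columns into an initial segment of positions, whose
      length is then the divider.\<close>
    have c: "x \<le> c i \<longleftrightarrow> w (\<sigma> x) \<le> i" if "x \<in> {1..n}" "i \<le> k" for x i
    proof -
      have "{x \<in> {1..n}. w (\<sigma> x) \<le> i} = {1..card {x \<in> {1..n}. w (\<sigma> x) \<le> i}}"
      proof (rule down_closed_eq_initial[of _ n])
        fix x y assume "y \<in> {x \<in> {1..n}. w (\<sigma> x) \<le> i}" "1 \<le> x" "x \<le> y"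
        then show "x \<in> {x \<in> {1..n}. w (\<sigma> x) \<le> i}" using ord[of x y] by (cases "x = y") auto
      qed auto
      then have "{x \<in> {1..n}. w (\<sigma> x) \<le> i} = {1..c i}" using that by (simp add: c_def)
      then have "x \<in> {x \<in> {1..n}. w (\<sigma> x) \<le> i} \<longleftrightarrow> x \<in> {1..c i}" by (simp only:)
      then show ?thesis using that by simp
    qed
    have div: "is_divider_seq n k c"
      unfolding is_divider_seq_def
    proof (intro conjI ballI)
      have "{x \<in> {1..n}. w (\<sigma> x) \<le> 0} = {}" using w s by fastforce
      then show "c 0 = 0" unfolding c_def by (simp only: restrict_apply card.empty) simp
      have "{x \<in> {1..n}. w (\<sigma> x) \<le> k} = {1..n}" using w s by fastforce
      then show "c k = n" unfolding c_def by (simp only: restrict_apply) simp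
      fix i assume "i \<in> {1..k}"
      then show "c (i - 1) \<le> c i" unfolding c_def by (auto intro!: card_mono)
    qed
    have col: "column_of c x = w (\<sigma> x)" if "x \<in> {1..n}" for x
    proof -
      have "column_of c x \<le> i \<longleftrightarrow> w (\<sigma> x) \<le> i" if "i \<le> k" for i
        using column_of_le_iff[OF div _ that] c that \<open>x \<in> {1..n}\<close> by auto
      moreover have "column_of c x \<le> k" "w (\<sigma> x) \<le> k"
        using column_of_range[OF div that] w[OF s[OF that]] by auto
      ultimately show ?thesis by (meson order_antisym order_refl)
    qed
    have "fits_columns k m \<sigma> c"
      unfolding fits_columns_def
    proof
      fix i assume i: "i \<in> {1..k}"
      let ?A = "{c (i - 1)<..c i}"
      have A: "x \<in> {1..n} \<and> w (\<sigma> x) = i" if "x \<in> ?A" for x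
      proof -
        have x: "x \<in> {1..n}" using that cell_subset[OF div i] by blast
        then show ?thesis using column_of_eq_iff[OF div x i] col[OF x] that by simp
      qed
      have *: "if m i = Increasing then \<sigma> x < \<sigma> y else \<sigma> y < \<sigma> x"
        if "x \<in> ?A" "y \<in> ?A" "x < y" for x y
        using ord[of x y] A that by auto
      show "fits_cell (m i) \<sigma> ?A"
      proof (cases "m i = Increasing")
        case True
        have "strict_mono_on ?A \<sigma>" using * True by (intro strict_mono_onI) auto
        with True show ?thesis by simp
      next
        case False
        then have "m i = Decreasing" using types i by blast
        moreover have "strict_antimono_on ?A \<sigma>" using * False by (auto simp: monotone_on_def)
        ultimately show ?thesis by simp
      qed
    qed
    then have mem: "(\<sigma>, c) \<in> gridded_perms k m n"
      using perm div by (simp add: gridded_perms_def c_def)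
    have "word_of n (\<sigma>, c) = xs"
    proof (rule nth_equalityI)
      show "length (word_of n (\<sigma>, c)) = length xs"
        using xs by (simp add: word_of_def words_def del: upt_Suc)
      fix j assume "j < length (word_of n (\<sigma>, c))"
      then have j: "Suc j \<in> {1..n}" by (simp add: word_of_def del: upt_Suc)
      have "inv \<sigma> (Suc j) \<in> {1..n}"
        using j permutes_in_image[OF permutes_inv[OF perm]] by blast
      then have "column_of c (inv \<sigma> (Suc j)) = xs ! j"
        using col permutes_inverses(1)[OF perm] by (simp add: w_def)
      then show "word_of n (\<sigma>, c) ! j = xs ! j" using word_of_nth[OF j] by simp
    qed
    with mem show "xs \<in> word_of n ` gridded_perms k m n" by blast
  qed
qed

section \<open>Griddings of one permutation\<close>

definition step_type :: "(nat \<Rightarrow> nat) \<Rightarrow> nat \<Rightarrow> cell" where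
  "step_type \<sigma> j = (if \<sigma> j < \<sigma> (Suc j) then Increasing else Decreasing)"

lemma fits_cell_interval_iff:
  assumes inj: "inj \<sigma>" and t: "t = Increasing \<or> t = Decreasing"
  shows "fits_cell t \<sigma> {a<..b} \<longleftrightarrow> (\<forall>j. a < j \<and> j < b \<longrightarrow> step_type \<sigma> j = t)"
proof -
  have ne: "\<sigma> j \<noteq> \<sigma> (Suc j)" for j using injD[OF inj, of j "Suc j"] by auto
  from t show ?thesis
  proof
    assume t: "t = Increasing"
    show ?thesis
    proof
      assume f: "fits_cell t \<sigma> {a<..b}"
      show "\<forall>j. a < j \<and> j < b \<longrightarrow> step_type \<sigma> j = t"
      proof (intro allI impI)
        fix j assume "a < j \<and> j < b"
        then have "\<sigma> j < \<sigma> (Suc j)" using f t by (auto intro: strict_mono_onD)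
        then show "step_type \<sigma> j = t" using t by (simp add: step_type_def)
      qed
    next
      assume f: "\<forall>j. a < j \<and> j < b \<longrightarrow> step_type \<sigma> j = t"
      have "\<sigma> x < \<sigma> y" if "a < x" "Suc x \<le> y" "y \<le> b" for x y
        using that(2,3)
      proof (induction y rule: dec_induct)
        case base then show ?case using f that(1) t by (auto simp: step_type_def split: if_splits)
      next
        case (step y)
        then have "step_type \<sigma> y = Increasing" using f that(1) t by auto
        then have "\<sigma> y < \<sigma> (Suc y)" by (auto simp: step_type_def split: if_splits)
        with step show ?case by auto
      qed
      then show "fits_cell t \<sigma> {a<..b}" using t by (auto intro!: strict_mono_onI)
    qed
  next
    assume t: "t = Decreasing"
    show ?thesis
    proof
      assume f: "fits_cell t \<sigma> {a<..b}"
      show "\<forall>j. a < j \<and> j < b \<longrightarrow> step_type \<sigma> j = t"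
      proof (intro allI impI)
        fix j assume "a < j \<and> j < b"
        then have "\<sigma> (Suc j) < \<sigma> j" using f t by (auto simp: monotone_on_def)
        then show "step_type \<sigma> j = t" using t by (simp add: step_type_def)
      qed
    next
      assume f: "\<forall>j. a < j \<and> j < b \<longrightarrow> step_type \<sigma> j = t"
      have down: "\<sigma> (Suc x) < \<sigma> x" if "a < x" "x < b" for x
        using f that t ne[of x] by (auto simp: step_type_def split: if_splits)
      have "\<sigma> y < \<sigma> x" if "a < x" "Suc x \<le> y" "y \<le> b" for x y
        using that(2,3)
      proof (induction y rule: dec_induct)
        case base then show ?case using down that(1) by auto
      next
        case (step y)
        with down[of y] that(1) show ?case by auto
      qed
      then show "fits_cell t \<sigma> {a<..b}" using t by (auto simp: monotone_on_def)
    qed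
  qed
qed

text \<open>Here \<open>E j\<close> is the direction of the step from position \<open>j\<close> to \<open>j + 1\<close>. Column \<open>i + 1\<close> may be
  stretched over everything from \<open>lo i\<close> to \<open>hi (i + 1)\<close>, so any choice of dividers between the bounds
  is valid. Conversely, going from left to right, no divider gets beyond \<open>hi\<close>: if divider \<open>i\<close> were
  the first to do so, column \<open>i\<close> would contain the step at \<open>hi i\<close>, which has the wrong direction. The
  lower bounds follow in the same way from right to left.\<close>

lemma dividers_eq_PiE:
  fixes E m :: "nat \<Rightarrow> cell" and lo hi :: "nat \<Rightarrow> nat"
  assumes ends: "lo 0 = 0" "hi 0 = 0" "lo k = n" "hi k = n"
    and sep: "\<And>i. i < k \<Longrightarrow> hi i \<le> lo (Suc i)"
    and lo_less: "\<And>i. i < k \<Longrightarrow> lo i < lo (Suc i)"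
    and hi_less: "\<And>i. i < k \<Longrightarrow> hi i < hi (Suc i)"
    and inside: "\<And>i j. i < k \<Longrightarrow> lo i < j \<Longrightarrow> j < hi (Suc i) \<Longrightarrow> E j = m (Suc i)"
    and stop_hi: "\<And>i. 0 < i \<Longrightarrow> i < k \<Longrightarrow> E (hi i) \<noteq> m i"
    and stop_lo: "\<And>i. 0 < i \<Longrightarrow> i < k \<Longrightarrow> E (lo i) \<noteq> m (Suc i)"
  shows "{c \<in> extensional {0..k}. is_divider_seq n k c \<and>
      (\<forall>i\<in>{1..k}. \<forall>j. c (i - 1) < j \<and> j < c i \<longrightarrow> E j = m i)} = (\<Pi>\<^sub>E i\<in>{0..k}. {lo i..hi i})"
    (is "?L = ?R")
proof (intro equalityI subsetI)
  fix c assume "c \<in> ?L"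
  then have ext: "c \<in> extensional {0..k}" and c0: "c 0 = 0" and ck: "c k = n"
    and E: "\<And>i j. i < k \<Longrightarrow> c i < j \<Longrightarrow> j < c (Suc i) \<Longrightarrow> E j = m (Suc i)"
    by (force simp: is_divider_seq_def)+
  have up: "c i \<le> hi i" if "i \<le> k" for i
    using that
  proof (induction i)
    case (Suc i)
    show ?case
    proof (cases "Suc i = k")
      case False
      show ?thesis
      proof (rule ccontr)
        assume "\<not> ?thesis"
        moreover have "c i < hi (Suc i)" using Suc hi_less[of i] by simp
        ultimately have "E (hi (Suc i)) = m (Suc i)" using E[of i "hi (Suc i)"] Suc by simp
        with stop_hi[of "Suc i"] False Suc show False by simp
      qed
    qed (use ck ends in simp)
  qed (use c0 in simp)
  have down: "lo i \<le> c i" if "i \<le> k" for i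
    using that
  proof (induction i rule: inc_induct)
    case (step i)
    show ?case
    proof (cases "i = 0")
      case False
      show ?thesis
      proof (rule ccontr)
        assume "\<not> ?thesis"
        moreover have "lo i < c (Suc i)" using step lo_less[of i] by simp
        ultimately have "E (lo i) = m (Suc i)" using E[of i "lo i"] step by simp
        with stop_lo[of i] False step show False by simp
      qed
    qed (use ends in simp)
  qed (use ck ends in simp)
  show "c \<in> ?R" using ext up down by (auto simp: PiE_iff)
next
  fix c assume "c \<in> ?R"
  then have ext: "c \<in> extensional {0..k}" and c: "\<And>i. i \<le> k \<Longrightarrow> lo i \<le> c i \<and> c i \<le> hi i"
    by (auto simp: PiE_iff)
  have "c (i - 1) \<le> c i \<and> (\<forall>j. c (i - 1) < j \<and> j < c i \<longrightarrow> E j = m i)" if "i \<in> {1..k}" for i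
  proof -
    define i' where "i' = i - 1"
    have i': "i = Suc i'" "i' < k" using that by (auto simp: i'_def)
    have "lo i' \<le> c i'" "c i' \<le> hi i'" "lo i \<le> c i" "c i \<le> hi i" using c[of i] c[of i'] i' by auto
    with i' sep[of i'] inside[of i'] show ?thesis by auto
  qed
  then show "c \<in> ?L" using ext c[of 0] c[of k] ends by (auto simp: is_divider_seq_def)
qed

text \<open>At a peak the step at the divider follows the type of one of the two columns. If it follows
  the left one, the extreme point is the first point of the right column and the divider may be
  increased by one; otherwise the extreme point is the last point of the left column and the
  divider may be decreased by one. Two points in each column leave room for these moves to be
  made at all peaks simultaneously.\<close>

lemma card_griddings_of_separated:
  assumes k: "k \<ge> 1"
    and types: "\<forall>i\<in>{1..k}. m i = Increasing \<or> m i = Decreasing"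
    and perm: "\<sigma> permutes {1..n}"
    and div: "is_divider_seq n k c" and fits: "fits_columns k m \<sigma> c"
    and large: "\<And>i. i < k \<Longrightarrow> c i + 2 \<le> c (Suc i)"
    and break: "\<And>i. 0 < i \<Longrightarrow> i < k \<Longrightarrow> m i = m (Suc i) \<Longrightarrow> step_type \<sigma> (c i) \<noteq> m i"
  shows "card {d. (\<sigma>, d) \<in> gridded_perms k m n} = 2 ^ card {i \<in> {1..k - 1}. m i \<noteq> m (i + 1)}"
proof -
  define E where "E = step_type \<sigma>"
  define pk where "pk = {i \<in> {1..k - 1}. m i \<noteq> m (i + 1)}"
  define lo where "lo i = (if i \<in> pk \<and> E (c i) \<noteq> m i then c i - 1 else c i)" for i
  define hi where "hi i = (if i \<in> pk \<and> E (c i) = m i then c i + 1 else c i)" for i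
  have inj: "inj \<sigma>" using permutes_inj[OF perm] .
  have fits_iff: "fits_columns k m \<sigma> d \<longleftrightarrow>
      (\<forall>i\<in>{1..k}. \<forall>j. d (i - 1) < j \<and> j < d i \<longrightarrow> E j = m i)" for d
    unfolding fits_columns_def E_def using fits_cell_interval_iff[OF inj] types by simp
  have Ec: "E j = m (Suc i)" if "i < k" "c i < j" "j < c (Suc i)" for i j
    using fits[unfolded fits_iff] that by (metis Suc_leI atLeastAtMost_iff diff_Suc_1 le_add1 plus_1_eq_Suc)
  have Etype: "E j = Increasing \<or> E j = Decreasing" for j by (simp add: E_def step_type_def)
  have mtype: "m i = Increasing \<or> m i = Decreasing" if "0 < i" "i \<le> k" for i using types that by auto
  have c0: "c 0 = 0" "c k = n" using div by (auto simp: is_divider_seq_def)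
  have pos: "c i \<ge> 2" if "0 < i" "i \<le> k" for i
    using large[of "i - 1"] that by (cases i) auto
  have pk: "i \<in> pk \<longleftrightarrow> 0 < i \<and> i < k \<and> m i \<noteq> m (Suc i)" for i using k unfolding pk_def by auto
  have lo_le: "lo i \<le> c i" "c i \<le> lo i + 1" and hi_le: "c i \<le> hi i" "hi i \<le> c i + 1" for i
    unfolding lo_def hi_def by auto
  have "{d. (\<sigma>, d) \<in> gridded_perms k m n} = {d \<in> extensional {0..k}. is_divider_seq n k d \<and>
      (\<forall>i\<in>{1..k}. \<forall>j. d (i - 1) < j \<and> j < d i \<longrightarrow> E j = m i)}"
    using perm fits_iff by (auto simp: gridded_perms_def)
  also have "\<dots> = (\<Pi>\<^sub>E i\<in>{0..k}. {lo i..hi i})"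
  proof (rule dividers_eq_PiE)
    show "lo 0 = 0" "hi 0 = 0" "lo k = n" "hi k = n" using pk c0 by (auto simp: lo_def hi_def)
  next
    fix i assume "i < k"
    with large[of i] lo_le[of i] lo_le[of "Suc i"] hi_le[of i] hi_le[of "Suc i"]
    show "hi i \<le> lo (Suc i)" "lo i < lo (Suc i)" "hi i < hi (Suc i)" by linarith+
  next
    fix i j assume i: "i < k" and j: "lo i < j" "j < hi (Suc i)"
    \<comment> \<open>Besides the steps inside the original column there is at most one further step on each side,
      where the adjacent peak point has been included.\<close>
    consider "j = c i" | "j = c (Suc i)" | "c i < j" "j < c (Suc i)"
      using j lo_le[of i] hi_le[of "Suc i"] by linarith
    then show "E j = m (Suc i)"
    proof cases
      case 1
      then have "i \<in> pk" "E (c i) \<noteq> m i" using j by (auto simp: lo_def split: if_splits)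
      then show ?thesis using 1 Etype[of j] mtype[of i] mtype[of "Suc i"] i pk[of i] by auto
    next
      case 2
      then show ?thesis using j by (auto simp: hi_def split: if_splits)
    next
      case 3 then show ?thesis using Ec i by blast
    qed
  next
    fix i assume i: "0 < i" "i < k"
    show "E (hi i) \<noteq> m i"
    proof (cases "i \<in> pk \<and> E (c i) = m i")
      case True
      then have "hi i = c i + 1" by (simp add: hi_def)
      then have "E (hi i) = m (Suc i)" using Ec[of i] large[of i] i by simp
      with True pk[of i] show ?thesis by metis
    next
      case False
      then have "hi i = c i" by (simp only: hi_def if_False)
      with False pk[of i] break[OF i] i show ?thesis by (auto simp: E_def)
    qed
    show "E (lo i) \<noteq> m (Suc i)"
    proof (cases "i \<in> pk \<and> E (c i) \<noteq> m i")
      case True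
      then have "lo i = c i - 1" by (simp add: lo_def)
      moreover have "c (i - 1) + 2 \<le> c i" using large[of "i - 1"] i by simp
      ultimately have "E (lo i) = m i" using Ec[of "i - 1" "c i - 1"] i by simp
      with True pk[of i] show ?thesis by metis
    next
      case False
      then have "lo i = c i" by (simp only: lo_def if_False)
      with False pk[of i] break[OF i] i show ?thesis by (auto simp: E_def)
    qed
  qed
  finally have "card {d. (\<sigma>, d) \<in> gridded_perms k m n} = (\<Prod>i\<in>{0..k}. card {lo i..hi i})"
    by (simp add: card_PiE)
  also have "\<dots> = (\<Prod>i\<in>{0..k}. if i \<in> pk then 2 else 1)"
  proof (rule prod.cong)
    fix i assume "i \<in> {0..k}"
    then show "card {lo i..hi i} = (if i \<in> pk then 2 else 1)"
      using pos[of i] pk[of i] by (auto simp: lo_def hi_def)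
  qed simp
  also have "\<dots> = 2 ^ card ({0..k} \<inter> pk)"
    by (simp add: prod.If_cases)
  also have "{0..k} \<inter> pk = pk" unfolding pk_def by auto
  finally show ?thesis unfolding pk_def .
qed

text \<open>Two copies of the alphabet: the letter \<open>i\<close> of the second copy comes after the letter
  \<open>i + 1\<close> of the first, while the letter \<open>i\<close> of the first comes before it.\<close>

definition generic_block :: "nat \<Rightarrow> nat list" where
  "generic_block k = [1..<Suc k] @ [1..<Suc k]"

text \<open>For two increasing columns \<open>i\<close> and \<open>i + 1\<close>, the last value of column \<open>i\<close> is its largest and
  the first value of column \<open>i + 1\<close> its smallest; a letter \<open>i + 1\<close> standing before a letter \<open>i\<close>
  therefore forces a descent at the divider. For two decreasing columns a letter \<open>i\<close> standing
  before a letter \<open>i + 1\<close> forces an ascent.\<close>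

lemma card_griddings_of_generic:
  assumes k: "k \<ge> 1"
    and types: "\<forall>i\<in>{1..k}. m i = Increasing \<or> m i = Decreasing"
    and mem: "(\<sigma>, c) \<in> gridded_perms k m n"
    and generic: "sublist (generic_block k) (word_of n (\<sigma>, c))"
  shows "card {d. (\<sigma>, d) \<in> gridded_perms k m n} = 2 ^ card {i \<in> {1..k - 1}. m i \<noteq> m (i + 1)}"
proof -
  have perm: "\<sigma> permutes {1..n}" and div: "is_divider_seq n k c" and fits: "fits_columns k m \<sigma> c"
    using mem by (auto simp: gridded_perms_def)
  obtain as bs where w: "word_of n (\<sigma>, c) = as @ generic_block k @ bs"
    using generic by (auto simp: sublist_def)
  define s where "s = length as"
  have "length (word_of n (\<sigma>, c)) = n" by (simp add: word_of_def del: upt_Suc)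
  then have len: "s + 2 * k \<le> n" unfolding w s_def by (simp add: generic_block_def del: upt_Suc)
  \<comment> \<open>In the two copies of the alphabet, which start after the value \<open>s\<close>, the letter \<open>i\<close> stands at
    the values \<open>s + i\<close> and \<open>s + k + i\<close>.\<close>
  have pt: "inv \<sigma> v \<in> {c (i - 1)<..c i}"
    if v: "v = s + i \<or> v = s + k + i" and i: "i \<in> {1..k}" for v i
  proof -
    have vn: "v \<in> {1..n}" using len that by auto
    have "word_of n (\<sigma>, c) ! (v - 1) = generic_block k ! (v - 1 - s)"
    proof -
      have "v - 1 = length as + (v - 1 - s)" "v - 1 - s < length (generic_block k)"
        using v i by (auto simp: s_def generic_block_def simp del: upt_Suc)
      then show ?thesis unfolding w by (metis nth_append_length_plus nth_append)
    qed
    also have "\<dots> = i" using v i by (auto simp: generic_block_def nth_append simp del: upt_Suc)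
    finally have "column_of c (inv \<sigma> v) = i" using word_of_nth[OF vn] by simp
    moreover have "inv \<sigma> v \<in> {1..n}"
      using vn permutes_in_image[OF permutes_inv[OF perm]] by blast
    ultimately show ?thesis using column_of_eq_iff[OF div _ i] by blast
  qed
  have inv: "\<sigma> (inv \<sigma> v) = v" for v using permutes_inverses(1)[OF perm] .
  have large: "c i + 2 \<le> c (Suc i)" if "i < k" for i
  proof -
    have "inv \<sigma> (s + Suc i) \<noteq> inv \<sigma> (s + k + Suc i)"
      using inv[of "s + Suc i"] inv[of "s + k + Suc i"] k by fastforce
    moreover have "inv \<sigma> (s + Suc i) \<in> {c i<..c (Suc i)}" "inv \<sigma> (s + k + Suc i) \<in> {c i<..c (Suc i)}"
      using pt[of _ "Suc i"] that by auto
    ultimately show ?thesis by auto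
  qed
  have "step_type \<sigma> (c i) \<noteq> m i" if i: "0 < i" "i < k" and eq: "m i = m (Suc i)" for i
  proof -
    let ?A = "{c (i - 1)<..c i}" and ?B = "{c i<..c (Suc i)}"
    have fA: "fits_cell (m i) \<sigma> ?A" and fB: "fits_cell (m i) \<sigma> ?B"
      using bspec[OF fits[unfolded fits_columns_def], of i]
        bspec[OF fits[unfolded fits_columns_def], of "Suc i"] i eq by auto
    have pA: "inv \<sigma> (s + i) \<in> ?A" "inv \<sigma> (s + k + i) \<in> ?A" using pt[of _ i] i by auto
    have pB: "inv \<sigma> (s + Suc i) \<in> ?B" using pt[of _ "Suc i"] i by auto
    have cA: "c i \<in> ?A" and cB: "Suc (c i) \<in> ?B" using large[of "i - 1"] large[of i] i by (cases i; auto)+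
    have "m i = Increasing \<or> m i = Decreasing" using types i by auto
    then show ?thesis
    proof
      assume t: "m i = Increasing"
      have incr: "\<sigma> x \<le> \<sigma> y" if "fits_cell (m i) \<sigma> A" "x \<in> A" "y \<in> A" "x \<le> y" for x y A
        using that t by (cases "x = y") (auto simp: monotone_on_def less_imp_le)
      have "\<sigma> (inv \<sigma> (s + k + i)) \<le> \<sigma> (c i)" using incr[OF fA pA(2) cA] pA by auto
      moreover have "\<sigma> (Suc (c i)) \<le> \<sigma> (inv \<sigma> (s + Suc i))" using incr[OF fB cB pB] pB by auto
      ultimately have "\<sigma> (Suc (c i)) \<le> \<sigma> (c i)" using i by (simp add: inv)
      then show ?thesis using t by (simp add: step_type_def)
    next
      assume t: "m i = Decreasing"
      have anti: "\<sigma> y \<le> \<sigma> x" if "fits_cell (m i) \<sigma> A" "x \<in> A" "y \<in> A" "x \<le> y" for x y A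
        using that t by (cases "x = y") (auto simp: monotone_on_def less_imp_le)
      have "\<sigma> (c i) \<le> \<sigma> (inv \<sigma> (s + i))" using anti[OF fA pA(1) cA] pA by auto
      moreover have "\<sigma> (inv \<sigma> (s + Suc i)) \<le> \<sigma> (Suc (c i))" using anti[OF fB cB pB] pB by auto
      ultimately have "\<sigma> (c i) < \<sigma> (Suc (c i))" by (simp add: inv)
      then show ?thesis using t by (simp add: step_type_def)
    qed
  qed
  with card_griddings_of_separated[OF k types perm div fits large] show ?thesis by blast
qed

section \<open>Counting\<close>

text \<open>With a single row the row dividers are forced to be \<open>0\<close> and \<open>n\<close>, so only the column dividers
  matter.\<close>

lemma Grid_single_row:
  assumes "k \<ge> 1"
  shows "Grid k 1 M n = fst ` gridded_perms k (\<lambda>i. M i 1) n"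
proof -
  have cells: "{x \<in> {c (i - 1)<..c i}. \<sigma> x \<in> {0<..n}} = {c (i - 1)<..c i}"
    if "\<sigma> permutes {1..n}" "is_divider_seq n k c" "i \<in> {1..k}" for \<sigma> c i
    using cell_subset[OF that(2,3)] permutes_in_image[OF that(1)]
    by (auto simp: Suc_le_eq subset_iff)
  show ?thesis
  proof (intro equalityI subsetI)
    fix \<sigma> assume "\<sigma> \<in> Grid k 1 M n"
    then obtain c r where p: "\<sigma> permutes {1..n}" and g: "is_gridding k 1 M n \<sigma> c r"
      by (auto simp: Grid_def)
    then have div: "is_divider_seq n k c" and r: "r 0 = 0" "r 1 = n"
      and f: "\<forall>i\<in>{1..k}. fits_cell (M i 1) \<sigma> {x \<in> {c (i - 1)<..c i}. \<sigma> x \<in> {r (1 - 1)<..r 1}}"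
      by (auto simp: is_gridding_def is_divider_seq_def)
    let ?d = "restrict c {0..k}"
    have "is_divider_seq n k ?d" using div by (auto simp: is_divider_seq_def)
    moreover have "fits_columns k (\<lambda>i. M i 1) \<sigma> ?d"
      unfolding fits_columns_def
    proof
      fix i assume i: "i \<in> {1..k}"
      then have "fits_cell (M i 1) \<sigma> {c (i - 1)<..c i}"
        using bspec[OF f i] cells[OF p div i] r by simp
      moreover have "?d (i - 1) = c (i - 1)" "?d i = c i" using i by auto
      ultimately show "fits_cell (M i 1) \<sigma> {?d (i - 1)<..?d i}" by simp
    qed
    ultimately have "(\<sigma>, ?d) \<in> gridded_perms k (\<lambda>i. M i 1) n"
      using p by (simp add: gridded_perms_def)
    then show "\<sigma> \<in> fst ` gridded_perms k (\<lambda>i. M i 1) n" by force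
  next
    fix \<sigma> assume "\<sigma> \<in> fst ` gridded_perms k (\<lambda>i. M i 1) n"
    then obtain c where p: "\<sigma> permutes {1..n}" and div: "is_divider_seq n k c"
      and f: "fits_columns k (\<lambda>i. M i 1) \<sigma> c"
      by (auto simp: gridded_perms_def)
    define r where "r = (\<lambda>j::nat. if j = 0 then 0 else n)"
    have "is_divider_seq n 1 r" by (simp add: is_divider_seq_def r_def)
    moreover have "fits_cell (M i j) \<sigma> {x \<in> {c (i - 1)<..c i}. \<sigma> x \<in> {r (j - 1)<..r j}}"
      if i: "i \<in> {1..k}" and j: "j \<in> {1..1}" for i j
    proof -
      have "j = 1" using j by simp
      then show ?thesis
        using f i cells[OF p div i] by (simp add: fits_columns_def r_def)
    qed
    ultimately have "is_gridding k 1 M n \<sigma> c r" using div by (simp add: is_gridding_def)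
    with p show "\<sigma> \<in> Grid k 1 M n" unfolding Grid_def by blast
  qed
qed

text \<open>A double count: away from the exceptional set \<open>B\<close> each first component accounts for exactly \<open>q\<close>
  pairs. The first components \<open>R\<close> that are not of this kind occur only in pairs of \<open>B\<close>, so there
  are at most \<open>card B\<close> of them, and they account for at most \<open>card B\<close> pairs.\<close>

lemma card_fst_image_bounds:
  fixes A B :: "('a \<times> 'b) set"
  assumes fin: "finite A" and BA: "B \<subseteq> A"
    and fib: "\<And>x y. (x, y) \<in> A - B \<Longrightarrow> card {z. (x, z) \<in> A} = q"
  shows "q * card (fst ` A) \<le> card A + q * card B" "card A \<le> q * card (fst ` A) + card B"
proof -
  define X where "X = fst ` (A - B)"
  define R where "R = fst ` A - X"
  define AX where "AX = {p \<in> A. fst p \<in> X}"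
  have fX: "finite X" "finite R" unfolding X_def R_def using fin by auto
  have "AX = (SIGMA x:X. {z. (x, z) \<in> A})" unfolding AX_def by auto
  moreover have "finite {z. (x, z) \<in> A}" for x
    by (rule finite_subset[OF _ finite_imageI[OF fin, of snd]]) force
  ultimately have "card AX = (\<Sum>x\<in>X. card {z. (x, z) \<in> A})"
    using fX by (simp add: card_SigmaI)
  also have "\<dots> = (\<Sum>x\<in>X. q)"
    by (rule sum.cong) (use fib in \<open>auto simp: X_def\<close>)
  finally have AX: "card AX = q * card X" by simp
  have split: "card (fst ` A) = card X + card R"
  proof -
    have "fst ` A = X \<union> R" "X \<inter> R = {}" unfolding R_def X_def by auto
    then show ?thesis using card_Un_disjoint[OF fX] by simp
  qed
  have finB: "finite B" using fin BA by (rule finite_subset[rotated])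
  have R: "card R \<le> card B"
    by (rule surj_card_le[OF finB, of _ fst]) (auto simp: R_def X_def image_iff)
  have sub: "card AX \<le> card A" unfolding AX_def using fin by (intro card_mono) auto
  have "A \<subseteq> AX \<union> B" unfolding AX_def X_def by force
  then have "card A \<le> card (AX \<union> B)" using fin finB by (intro card_mono) (auto simp: AX_def)
  also have "\<dots> \<le> card AX + card B" by (rule card_Un_le)
  finally show "card A \<le> q * card (fst ` A) + card B"
    unfolding split AX by (simp add: algebra_simps trans_le_add1)
  show "q * card (fst ` A) \<le> card A + q * card B"
    unfolding split distrib_left using AX sub mult_le_mono2[OF R, of q] by linarith
qed

theorem theorem2p5:
  fixes M :: "nat \<Rightarrow> nat \<Rightarrow> cell" and k :: nat
  assumes "k \<ge> 1"
    and "\<forall>i\<in>{1..k}. M i 1 = Increasing \<or> M i 1 = Decreasing"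
  shows "asymp_equiv (\<lambda>n. real (card (Grid k 1 M n))) at_top
           (\<lambda>n. 2 powi (- int (peaks k M)) * real k ^ n)"
proof -
  define m where "m = (\<lambda>i. M i 1)"
  have types: "\<forall>i\<in>{1..k}. m i = Increasing \<or> m i = Decreasing" using assms(2) by (simp add: m_def)
  define p where "p = peaks k M"
  define P where "P = generic_block k"
  define bad where "bad n = {x \<in> gridded_perms k m n. \<not> sublist P (word_of n x)}" for n
  define b where "b n = real (card (avoiders {1..k} P n)) / real k ^ n" for n
  have k: "real k > 0" using assms(1) by simp
  have P: "set P \<subseteq> {1..k}" "P \<noteq> []"
    using assms(1) by (auto simp: P_def generic_block_def)
  have b0: "(\<lambda>n. b n) \<longlonglongrightarrow> 0"
    using avoiders_negligible[OF _ P] unfolding b_def by simp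
  have bounds: "\<bar>2 ^ p * real (card (Grid k 1 M n)) / real k ^ n - 1\<bar> \<le> 2 ^ p * b n" for n
  proof -
    let ?A = "gridded_perms k m n"
    note bij = word_of_bij[OF types, of n]
    have fw: "finite (words k n)" "card (words k n) = k ^ n"
      unfolding words_def using finite_lists_length_eq[of "{1..k}" n]
      by (auto simp: card_lists_length_eq)
    have fin: "finite ?A" using bij_betw_finite[OF bij] fw by simp
    have cardA: "card ?A = k ^ n" using bij_betw_same_card[OF bij] fw by simp
    have "word_of n ` bad n \<subseteq> avoiders {1..k} P n"
      using bij by (auto simp: bad_def avoiders_def bij_betw_def words_def)
    moreover have "inj_on (word_of n) (bad n)"
      using bij by (auto simp: bad_def bij_betw_def intro: inj_on_subset)
    ultimately have cardB: "card (bad n) \<le> card (avoiders {1..k} P n)"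
      by (intro card_inj_on_le[of "word_of n"]) (simp_all add: finite_avoiders)
    have fib: "card {z. (x, z) \<in> ?A} = 2 ^ p" if "(x, y) \<in> ?A - bad n" for x y
      using card_griddings_of_generic[OF assms(1) types, of x y n] that
      by (simp add: bad_def P_def p_def peaks_def m_def)
    have G: "Grid k 1 M n = fst ` ?A" unfolding m_def by (rule Grid_single_row[OF assms(1)])
    have 1: "2 ^ p * card (Grid k 1 M n) \<le> k ^ n + 2 ^ p * card (bad n)"
      and 2: "k ^ n \<le> 2 ^ p * card (Grid k 1 M n) + card (bad n)"
      using card_fst_image_bounds[OF fin, of "bad n" "2 ^ p"] fib
      unfolding G cardA by (auto simp: bad_def)
    have 1: "2 ^ p * real (card (Grid k 1 M n)) \<le> real k ^ n + 2 ^ p * real (card (bad n))"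
      using of_nat_mono[OF 1, where ?'a = real] by simp
    have 2: "real k ^ n \<le> 2 ^ p * real (card (Grid k 1 M n)) + real (card (bad n))"
      using of_nat_mono[OF 2, where ?'a = real] by simp
    have B: "real (card (bad n)) \<le> b n * real k ^ n" using cardB k by (simp add: b_def)
    have B1: "real (card (bad n)) \<le> 2 ^ p * real (card (bad n))"
      using mult_right_mono[of 1 "2 ^ p" "real (card (bad n))"] by simp
    have B2: "2 ^ p * real (card (bad n)) \<le> 2 ^ p * (b n * real k ^ n)"
      using B by (intro mult_left_mono) auto
    have "\<bar>2 ^ p * real (card (Grid k 1 M n)) - real k ^ n\<bar> \<le> 2 ^ p * b n * real k ^ n"
      unfolding mult.assoc using 1 2 B1 B2 by linarith
    moreover have "2 ^ p * real (card (Grid k 1 M n)) / real k ^ n - 1 =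
        (2 ^ p * real (card (Grid k 1 M n)) - real k ^ n) / real k ^ n"
      using k by (simp add: field_simps)
    ultimately show ?thesis using k by (simp add: divide_le_eq)
  qed
  have "(\<lambda>n. 2 ^ p * b n) \<longlonglongrightarrow> 0" using tendsto_mult_right_zero[OF b0] by simp
  then have "(\<lambda>n. 2 ^ p * real (card (Grid k 1 M n)) / real k ^ n - 1) \<longlonglongrightarrow> 0"
    by (rule tendsto_0_le[where K = 1]) (intro always_eventually allI, use order_trans[OF bounds abs_ge_self] in simp)
  then have "(\<lambda>n. 2 ^ p * real (card (Grid k 1 M n)) / real k ^ n) \<longlonglongrightarrow> 1"
    by (simp add: LIM_zero_iff)
  moreover have "2 ^ p * real (card (Grid k 1 M n)) / real k ^ n =
      real (card (Grid k 1 M n)) / (2 powi (- int p) * real k ^ n)" for n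
    by (simp add: power_int_minus field_simps)
  ultimately show ?thesis
    unfolding p_def[symmetric] using k by (intro asymp_equivI') simp
qed

end
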